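(* Let $\{k_n\}$ be a summability kernel on $\mathbb{T}$. If $f\in L^p(\mathbb{T})$ with $1\le p<\infty$, then $k_n*f\to f$ in $L^p(\mathbb{T})$ as $n\to\infty$. Similarly, if $f\in C(\mathbb{T})$ then $k_n*f\to f$ in $C(\mathbb{T})$.
   Context: $\mathbb{T}=\mathbb{R}/2\pi\mathbb{Z}$; functions are complex-valued and $2\pi$-periodic. $\|f\|_{L^p(\mathbb{T})}=\big(\frac{1}{2\pi}\int_{\mathbb{T}}|f|^p\,dt\big)^{1/p}$, and $C(\mathbb{T})$ is the space of continuous $2\pi$-periodic functions with the sup norm. Convolution is $(f*g)(t)=\frac{1}{2\pi}\int_{\mathbb{T}}f(t-\tau)g(\tau)\,d\tau$. A summability kernel is a sequence $\{k_n\}$ in $L^1(\mathbb{T})$ satisfying: (S1) $\frac{1}{2\pi}\int_{\mathbb{T}}k_n(t)\,dt=1$ for every $n$; (S2) $\sup_n\frac{1}{2\pi}\int_{\mathbb{T}}|k_n(t)|\,dt<\infty$; (S3) $\lim_{n\to\infty}\int_{\{\delta<|t|<\pi\}}|k_n(t)|\,dt=0$ for each $\delta\in(0,\pi)$. *)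

theory Defs
  imports "HOL-Analysis.Analysis"
begin

text \<open>Functions on \<open>\<real>/2\<pi>\<int>\<close> are represented by \<open>2\<pi>\<close>-periodic functions on \<open>real\<close>;
  integrals over the circle are Lebesgue integrals over the period interval \<open>{-pi..pi}\<close>.\<close>

definition periodic_2pi :: "(real \<Rightarrow> complex) \<Rightarrow> bool" where
  "periodic_2pi f \<longleftrightarrow> (\<forall>t. f (t + 2 * pi) = f t)"

text \<open>Elements of \<open>L\<^sup>p\<close> are represented by functions rather than by classes modulo null sets.\<close>

definition Lp_circle :: "real \<Rightarrow> (real \<Rightarrow> complex) set" where
  "Lp_circle p = {f. periodic_2pi f \<and> f \<in> borel_measurable lebesgue \<and>
     set_integrable lebesgue {-pi..pi} (\<lambda>t. norm (f t) powr p)}"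

definition Lp_norm_circle :: "real \<Rightarrow> (real \<Rightarrow> complex) \<Rightarrow> real" where
  "Lp_norm_circle p f =
     (1 / (2 * pi) * (LINT t:{-pi..pi}|lebesgue. norm (f t) powr p)) powr (1 / p)"

definition C_circle :: "(real \<Rightarrow> complex) set" where
  "C_circle = {f. periodic_2pi f \<and> continuous_on UNIV f}"

definition sup_norm_circle :: "(real \<Rightarrow> complex) \<Rightarrow> real" where
  "sup_norm_circle f = (SUP t. norm (f t))"

text \<open>Where \<open>\<lambda>\<tau>. f (t - \<tau>) * g \<tau>\<close> is not integrable, the value is \<open>0\<close> by the library's convention;
  for \<open>f, g\<close> in \<open>L\<^sup>1\<close> this happens only on a null set of \<open>t\<close>.\<close>

definition conv_circle :: "(real \<Rightarrow> complex) \<Rightarrow> (real \<Rightarrow> complex) \<Rightarrow> real \<Rightarrow> complex" where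
  "conv_circle f g t =
     complex_of_real (1 / (2 * pi)) * (LINT \<tau>:{-pi..pi}|lebesgue. f (t - \<tau>) * g \<tau>)"

definition summability_kernel :: "(nat \<Rightarrow> real \<Rightarrow> complex) \<Rightarrow> bool" where
  "summability_kernel k \<longleftrightarrow>
     (\<forall>n. k n \<in> Lp_circle 1) \<and>
     (\<forall>n. complex_of_real (1 / (2 * pi)) * (LINT t:{-pi..pi}|lebesgue. k n t) = 1) \<and>
     bdd_above (range (\<lambda>n. 1 / (2 * pi) * (LINT t:{-pi..pi}|lebesgue. norm (k n t)))) \<and>
     (\<forall>\<delta>. 0 < \<delta> \<and> \<delta> < pi \<longrightarrow>
        (\<lambda>n. LINT t:{t. \<delta> < \<bar>t\<bar> \<and> \<bar>t\<bar> < pi}|lebesgue. norm (k n t)) \<longlonglongrightarrow> 0)"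

text \<open>Convergence in a space includes membership of all terms and of the limit, because the
  norms above are total functions and say nothing outside the space.\<close>

definition converges_in_Lp :: "real \<Rightarrow> (nat \<Rightarrow> real \<Rightarrow> complex) \<Rightarrow> (real \<Rightarrow> complex) \<Rightarrow> bool" where
  "converges_in_Lp p g f \<longleftrightarrow> (\<forall>n. g n \<in> Lp_circle p) \<and> f \<in> Lp_circle p \<and>
     (\<lambda>n. Lp_norm_circle p (\<lambda>t. g n t - f t)) \<longlonglongrightarrow> 0"

definition converges_in_C :: "(nat \<Rightarrow> real \<Rightarrow> complex) \<Rightarrow> (real \<Rightarrow> complex) \<Rightarrow> bool" where
  "converges_in_C g f \<longleftrightarrow> (\<forall>n. g n \<in> C_circle) \<and> f \<in> C_circle \<and>
     (\<lambda>n. sup_norm_circle (\<lambda>t. g n t - f t)) \<longlonglongrightarrow> 0"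

end

theory Submission
  imports Defs
begin

text \<open>
  A summability kernel has mean \<open>1\<close>, so the error of the approximation is an average of differences of translates,
  \<open>(k n * f) t - f t = (1 / 2\<pi>) \<integral> k n s (f (t - s) - f t) ds\<close>.
  For small \<open>s\<close> the difference is small because translation acts continuously on both function spaces; for \<open>s\<close> away from \<open>0\<close>
  it is only bounded, but there the kernel has asymptotically no mass. The common principle is
  \<open>summability_kernel_uniform_decay\<close>: weights that are bounded, and uniformly small near \<open>0\<close>, have integrals against
  \<open>\<bar>k n\<bar>\<close> that tend to \<open>0\<close> uniformly.

  For continuous \<open>f\<close> the weights are the functions \<open>s \<mapsto> \<bar>f (t - s) - f t\<bar>\<close> for all \<open>t\<close> together, which are uniformly small near
  \<open>0\<close> by uniform continuity.

  For \<open>f\<close> in \<open>L\<^sup>p\<close>, Jensen's inequality (\<open>integral_weighted_power_mean\<close>) bounds \<open>\<bar>(k n * f) t - f t\<bar>\<^sup>p\<close> by a constant times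
  \<open>\<integral> \<bar>k n s\<bar> \<bar>f (t - s) - f t\<bar>\<^sup>p ds\<close>. Integrating over \<open>t\<close> and using Tonelli's theorem (\<open>tonelli_convolution_difference\<close>) leaves
  the single weight \<open>\<omega> s = \<integral> \<bar>f (t - s) - f t\<bar>\<^sup>p dt\<close>. It is bounded, and it tends to \<open>0\<close> with \<open>s\<close> by continuity of
  translation in \<open>L\<^sup>p\<close> (\<open>translation_continuous_in_Lp\<close>), which follows from the density of the continuous functions
  (\<open>continuous_dense_in_Lp\<close>).

  The iterated integrals are taken in the extended nonnegative reals, where they make sense before any integrability is known;
  that the convolution integral converges for almost every \<open>t\<close> is then a consequence of the finiteness of the double integral.
\<close>

section \<open>A weighted power mean inequality\<close>

text \<open>Convexity of \<open>y \<mapsto> y\<^sup>p\<close>, as the tangent line at \<open>c\<close>; after scaling by \<open>c\<close> this is Young's inequality with second factor \<open>1\<close>.\<close>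

lemma powr_tangent_le:
  fixes y c p :: real
  assumes "1 \<le> p" "0 \<le> y" "0 < c"
  shows "c powr p + p * c powr (p - 1) * (y - c) \<le> y powr p"
proof (cases "p = 1")
  case True
  then show ?thesis using assms by simp
next
  case False
  then have p: "p > 1" using assms by simp
  define x where "x = y / c"
  have x: "x \<ge> 0" and y: "y = c * x" using assms by (auto simp: x_def)
  have "x * 1 \<le> x powr p / p + 1 powr (p / (p - 1)) / (p / (p - 1))"
    by (rule Youngs_inequality) (use p x in \<open>auto simp: field_simps\<close>)
  then have "p * (x * 1) \<le> p * (x powr p / p + 1 powr (p / (p - 1)) / (p / (p - 1)))"
    using p by (intro mult_left_mono) auto
  also have "\<dots> = x powr p + (p - 1)"
    using p by (simp add: field_simps)
  finally have "p * x \<le> x powr p + (p - 1)" by simp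
  then have "c powr p * (1 + p * (x - 1)) \<le> c powr p * x powr p"
    by (intro mult_left_mono) (auto simp: algebra_simps)
  moreover have "c powr p = c powr (p - 1) * c"
    using assms by (simp add: powr_diff)
  moreover have "y powr p = c powr p * x powr p"
    using y x assms by (simp add: powr_mult)
  ultimately show ?thesis
    by (simp add: y algebra_simps)
qed

text \<open>Jensen's inequality for \<open>y \<mapsto> y\<^sup>p\<close> and the measure with density \<open>u\<close>, without normalising \<open>u\<close> to
  total mass \<open>1\<close>. It moves the power \<open>p\<close> inside a convolution integral, after which Tonelli's theorem
  applies; Minkowski's integral inequality is thereby avoided.\<close>

lemma integral_weighted_power_mean:
  fixes u y :: "'a \<Rightarrow> real"
  assumes p: "1 \<le> p" and u: "integrable M u" "\<And>x. 0 \<le> u x" "0 < (LINT x|M. u x)"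
    and y: "y \<in> borel_measurable M" "\<And>x. 0 \<le> y x"
    and uy: "integrable M (\<lambda>x. u x * y x powr p)"
  shows "integrable M (\<lambda>x. u x * y x)"
    and "(LINT x|M. u x * y x) powr p
         \<le> (LINT x|M. u x) powr (p - 1) * (LINT x|M. u x * y x powr p)"
proof -
  have [measurable]: "u \<in> borel_measurable M" "y \<in> borel_measurable M" using u y by auto
  have y_le: "y x \<le> 1 + y x powr p" for x
  proof (cases "y x \<le> 1")
    case False
    then have "y x powr 1 \<le> y x powr p" using p by (intro powr_mono) auto
    then show ?thesis using False by simp
  qed (simp add: add_increasing2)
  show int: "integrable M (\<lambda>x. u x * y x)"
  proof (rule Bochner_Integration.integrable_bound)
    show "integrable M (\<lambda>x. u x + u x * y x powr p)" using u uy by auto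
    show "AE x in M. norm (u x * y x) \<le> norm (u x + u x * y x powr p)"
    proof (rule AE_I2)
      fix x
      have "u x * y x \<le> u x * (1 + y x powr p)" using y_le u by (intro mult_left_mono) auto
      then show "norm (u x * y x) \<le> norm (u x + u x * y x powr p)"
        using u y by (simp add: algebra_simps)
    qed
  qed simp
  define U where "U = (LINT x|M. u x)"
  define A where "A = (LINT x|M. u x * y x)"
  define c where "c = A / U"
  have U: "U > 0" using u by (simp add: U_def)
  have A0: "A \<ge> 0" unfolding A_def using u y by (intro Bochner_Integration.integral_nonneg) auto
  show "(LINT x|M. u x * y x) powr p \<le> (LINT x|M. u x) powr (p - 1) * (LINT x|M. u x * y x powr p)"
  proof (cases "A = 0")
    case True
    have "0 \<le> (LINT x|M. u x * y x powr p)"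
      using u y by (intro Bochner_Integration.integral_nonneg) auto
    then show ?thesis using True p unfolding A_def by simp
  next
    case False
    then have c: "c > 0" using A0 U by (simp add: c_def)
    \<comment> \<open>The tangent at the mean value \<open>c\<close>: its linear part has weighted integral \<open>0\<close>.\<close>
    have "(LINT x|M. c powr p * u x + p * c powr (p - 1) * (u x * y x - c * u x))
          \<le> (LINT x|M. u x * y x powr p)"
    proof (rule integral_mono)
      fix x
      have "u x * (c powr p + p * c powr (p - 1) * (y x - c)) \<le> u x * y x powr p"
        using powr_tangent_le[OF p y(2) c] u by (intro mult_left_mono) auto
      then show "c powr p * u x + p * c powr (p - 1) * (u x * y x - c * u x) \<le> u x * y x powr p"
        by (simp add: algebra_simps)
    qed (use int u uy in auto)
    also have "(LINT x|M. c powr p * u x + p * c powr (p - 1) * (u x * y x - c * u x))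
             = c powr p * U + p * c powr (p - 1) * (A - c * U)"
      using int u by (simp add: U_def A_def)
    also have "\<dots> = c powr p * U" using U by (simp add: c_def)
    finally have "U powr (p - 1) * (c powr p * U) \<le> U powr (p - 1) * (LINT x|M. u x * y x powr p)"
      by (intro mult_left_mono) auto
    moreover have "U powr (p - 1) * (c powr p * U) = A powr p"
      using U A0 by (simp add: c_def powr_divide powr_diff)
    ultimately show ?thesis by (simp add: U_def A_def)
  qed
qed

text \<open>A triangle inequality for \<open>p\<close>-th powers, with a constant that suffices for showing that quantities are finite or tend to \<open>0\<close>.\<close>

lemma powr_add_le:
  fixes a b p :: real
  assumes "0 \<le> a" "0 \<le> b" "0 \<le> p"
  shows "(a + b) powr p \<le> 2 powr p * (a powr p + b powr p)"
proof -
  have "(a + b) powr p \<le> (2 * max a b) powr p" using assms by (intro powr_mono2) auto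
  also have "\<dots> = 2 powr p * max a b powr p" using assms by (simp add: powr_mult)
  also have "\<dots> \<le> 2 powr p * (a powr p + b powr p)"
    by (intro mult_left_mono) (auto simp: max_def)
  finally show ?thesis .
qed

lemma norm_add_powr_le:
  fixes x y :: "'a::real_normed_vector"
  assumes "0 \<le> p"
  shows "norm (x + y) powr p \<le> 2 powr p * (norm x powr p + norm y powr p)"
  by (rule order_trans[OF powr_mono2[OF assms _ norm_triangle_ineq] powr_add_le])
     (use assms in auto)

lemma norm_diff_powr_le:
  fixes x y :: "'a::real_normed_vector"
  assumes "0 \<le> p"
  shows "norm (x - y) powr p \<le> 2 powr p * (norm x powr p + norm y powr p)"
  using norm_add_powr_le[OF assms, of x "- y"] by simp

section \<open>Integrals of periodic functions\<close>

abbreviation circle_measure :: "real measure" where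
  "circle_measure \<equiv> lebesgue_on {-pi..pi}"

lemma periodic_plus_int:
  assumes h: "\<And>x::real. h (x + 2 * pi) = h x"
  shows "h (x + 2 * pi * of_int m) = h x"
proof -
  have nat: "h (x + 2 * pi * of_nat n) = h x" for x n
  proof (induction n)
    case (Suc n)
    have "h (x + 2 * pi * of_nat (Suc n)) = h (x + 2 * pi * of_nat n + 2 * pi)"
      by (simp add: algebra_simps)
    then show ?case using h Suc by simp
  qed simp
  show ?thesis
  proof (cases m rule: int_cases2)
    case (nonneg n) then show ?thesis using nat by simp
  next
    case (nonpos n) then show ?thesis using nat[of "x + 2 * pi * of_int m" n] by simp
  qed
qed

lemma periodic_reduce:
  assumes per: "\<And>x::real. f (x + 2 * pi) = f x"
  obtains r where "0 \<le> r" "r \<le> 2 * pi" "\<And>s. f (t - s) = f (r - s)"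
proof -
  define m where "m = \<lfloor>t / (2 * pi)\<rfloor>"
  define r where "r = t - 2 * pi * of_int m"
  have "of_int m \<le> t / (2 * pi)" "t / (2 * pi) < of_int m + 1"
    unfolding m_def by (auto simp: floor_correct)
  then have "0 \<le> r" "r \<le> 2 * pi" by (auto simp: r_def field_simps)
  moreover have "f (t - s) = f (r - s)" for s
    using periodic_plus_int[of f "r - s" m] per by (simp add: r_def algebra_simps)
  ultimately show thesis using that by blast
qed

lemma has_bochner_integral_lebesgue_shift:
  fixes h :: "real \<Rightarrow> 'a::euclidean_space"
  assumes "has_bochner_integral lebesgue (\<lambda>x. indicator {a..<b} x *\<^sub>R h x) i"
  shows "has_bochner_integral lebesgue (\<lambda>x. indicator {a + d..<b + d} x *\<^sub>R h (x - d)) i"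
proof -
  have "has_bochner_integral lebesgue (\<lambda>x. indicator {a..<b} (-d + 1 * x) *\<^sub>R h (-d + 1 * x)) (i /\<^sub>R \<bar>1\<bar>)"
    using assms by (subst (asm) has_bochner_integral_lebesgue_real_affine_iff[where t = "-d" and c = 1]) auto
  moreover have "(\<lambda>x. indicator {a..<b} (-d + 1 * x) *\<^sub>R h (-d + 1 * x))
      = (\<lambda>x. indicator {a + d..<b + d} x *\<^sub>R h (x - d))"
    by (auto simp: fun_eq_iff indicator_def)
  ultimately show ?thesis by simp
qed

text \<open>Moving the window over one period exchanges a piece at one end for its translate at the other. Half-open windows make
  the pieces disjoint, so that no endpoint is counted twice.\<close>

lemma has_bochner_integral_period_interval:
  fixes h :: "real \<Rightarrow> 'a::euclidean_space"
  assumes h: "\<And>x. h (x + 2 * pi) = h x"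
    and i: "has_bochner_integral lebesgue (\<lambda>x. indicator {a..<a + 2 * pi} x *\<^sub>R h x) i"
  shows "has_bochner_integral lebesgue (\<lambda>x. indicator {b..<b + 2 * pi} x *\<^sub>R h x) i"
proof -
  define m where "m = \<lfloor>(b - a) / (2 * pi)\<rfloor>"
  define d where "d = b - a - 2 * pi * of_int m"
  have "of_int m \<le> (b - a) / (2 * pi)" "(b - a) / (2 * pi) < of_int m + 1"
    unfolding m_def by (auto simp: floor_correct)
  then have d: "0 \<le> d" "d \<le> 2 * pi" by (auto simp: d_def field_simps)
  \<comment> \<open>Moving the window by \<open>d\<close> drops \<open>{a..<a + d}\<close> and gains the translate of that piece by \<open>2\<pi>\<close>.\<close>
  define J where "J = {a..<a + d}"
  have "integrable lebesgue (\<lambda>x. indicator J x *\<^sub>R (indicator {a..<a + 2 * pi} x *\<^sub>R h x))"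
    using i by (intro integrable_mult_indicator[OF _ integrable.intros]) (auto simp: J_def)
  moreover have "(\<lambda>x. indicator J x *\<^sub>R (indicator {a..<a + 2 * pi} x *\<^sub>R h x)) = (\<lambda>x. indicator J x *\<^sub>R h x)"
    using d by (auto simp: J_def fun_eq_iff indicator_def)
  ultimately obtain j where j: "has_bochner_integral lebesgue (\<lambda>x. indicator {a..<a + d} x *\<^sub>R h x) j"
    unfolding J_def using has_bochner_integral_integrable by metis
  from h have h': "h (x - 2 * pi) = h x" for x using h[of "x - 2 * pi"] by simp
  have j': "has_bochner_integral lebesgue (\<lambda>x. indicator {a + 2 * pi..<a + d + 2 * pi} x *\<^sub>R h x) j"
    using has_bochner_integral_lebesgue_shift[OF j, of "2 * pi"] by (simp add: h')
  have "has_bochner_integral lebesgue (\<lambda>x. indicator {a..<a + 2 * pi} x *\<^sub>R h x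
      - indicator {a..<a + d} x *\<^sub>R h x + indicator {a + 2 * pi..<a + d + 2 * pi} x *\<^sub>R h x) (i - j + j)"
    by (intro has_bochner_integral_add has_bochner_integral_diff i j j')
  moreover have "(\<lambda>x. indicator {a..<a + 2 * pi} x *\<^sub>R h x
      - indicator {a..<a + d} x *\<^sub>R h x + indicator {a + 2 * pi..<a + d + 2 * pi} x *\<^sub>R h x)
      = (\<lambda>x. indicator {a + d..<a + d + 2 * pi} x *\<^sub>R h x)"
    using d by (auto simp: fun_eq_iff indicator_def)
  ultimately have "has_bochner_integral lebesgue (\<lambda>x. indicator {a + d..<a + d + 2 * pi} x *\<^sub>R h x) i"
    by simp
  from has_bochner_integral_lebesgue_shift[OF this, of "2 * pi * of_int m"]
  have "has_bochner_integral lebesgue (\<lambda>x. indicator {b..<b + 2 * pi} x *\<^sub>R h (x - 2 * pi * of_int m)) i"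
    by (simp add: d_def algebra_simps)
  moreover have "h (x - 2 * pi * of_int m) = h x" for x
    using periodic_plus_int[of h x "-m"] h by simp
  ultimately show ?thesis by simp
qed

lemma has_bochner_integral_circle_iff:
  fixes h :: "real \<Rightarrow> 'a::euclidean_space"
  shows "has_bochner_integral circle_measure h i \<longleftrightarrow>
    has_bochner_integral lebesgue (\<lambda>x. indicator {-pi..<-pi + 2 * pi} x *\<^sub>R h x) i"
proof -
  define E where "E = {-pi..<-pi + 2 * pi}"
  have "{-pi..pi} = insert pi E" "pi \<notin> E" by (auto simp: E_def)
  then have split: "indicator {-pi..pi} x *\<^sub>R h x = indicator E x *\<^sub>R h x + indicator {pi} x *\<^sub>R h pi" for x
    by (auto simp: indicator_def)
  have pt: "has_bochner_integral lebesgue (\<lambda>x. indicator {pi} x *\<^sub>R h pi) 0"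
    using has_bochner_integral_scaleR_left[of "h pi" lebesgue "indicator {pi}" 0]
      has_bochner_integral_real_indicator[of "{pi}" lebesgue] by simp
  have "has_bochner_integral circle_measure h i \<longleftrightarrow>
      has_bochner_integral lebesgue (\<lambda>x. indicator {-pi..pi} x *\<^sub>R h x) i"
    by (rule has_bochner_integral_restrict_space) auto
  also have "\<dots> \<longleftrightarrow> has_bochner_integral lebesgue (\<lambda>x. indicator E x *\<^sub>R h x) i"
    using has_bochner_integral_add[OF _ pt, of "\<lambda>x. indicator E x *\<^sub>R h x" i]
      has_bochner_integral_diff[OF _ pt, of "\<lambda>x. indicator {-pi..pi} x *\<^sub>R h x" i]
    by (auto simp: split)
  finally show ?thesis by (simp add: E_def)
qed

lemma has_bochner_integral_circle_reflect:
  fixes h :: "real \<Rightarrow> 'a::euclidean_space"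
  assumes h: "\<And>x. h (x + 2 * pi) = h x" and i: "has_bochner_integral circle_measure h i"
  shows "has_bochner_integral circle_measure (\<lambda>s. h (t - s)) i"
proof -
  \<comment> \<open>First shift by \<open>t\<close>, then reflect; the reflection preserves the closed interval.\<close>
  have "has_bochner_integral lebesgue (\<lambda>x. indicator {t-pi..<(t-pi) + 2 * pi} x *\<^sub>R h x) i"
    using has_bochner_integral_period_interval[where h = h and a = "-pi", OF h] i unfolding has_bochner_integral_circle_iff by blast
  from has_bochner_integral_lebesgue_shift[OF this, of "-t"]
  have "has_bochner_integral circle_measure (\<lambda>x. h (x + t)) i"
    unfolding has_bochner_integral_circle_iff by (simp add: algebra_simps)
  from has_bochner_integral_reflect_real_lemma[OF this] show ?thesis by simp
qed

text \<open>The equivalence transfers non-integrability as well, so that the change of variables below also holds for integrals that take the default value \<open>0\<close>.\<close>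

lemma has_bochner_integral_circle_reflect_iff:
  fixes h :: "real \<Rightarrow> 'a::euclidean_space"
  assumes h: "\<And>x. h (x + 2 * pi) = h x"
  shows "has_bochner_integral circle_measure (\<lambda>s. h (t - s)) i \<longleftrightarrow> has_bochner_integral circle_measure h i"
proof
  have per: "h (t - (x + 2 * pi)) = h (t - x)" for x
    using h[of "t - x - 2 * pi"] by (simp add: algebra_simps)
  show "has_bochner_integral circle_measure h i" if "has_bochner_integral circle_measure (\<lambda>s. h (t - s)) i"
    using has_bochner_integral_circle_reflect[where h = "\<lambda>s. h (t - s)", OF per that, of t] by simp
qed (rule has_bochner_integral_circle_reflect[where h = h, OF h])

lemma integral_circle_reflect:
  fixes h :: "real \<Rightarrow> 'a::euclidean_space"
  assumes h: "\<And>x. h (x + 2 * pi) = h x"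
  shows "(LINT s|circle_measure. h (t - s)) = (LINT s|circle_measure. h s)"
  using has_bochner_integral_circle_reflect_iff[where h = h, OF h, of t]
  unfolding has_bochner_integral_iff by (metis not_integrable_integral_eq)

lemma has_bochner_integral_circle_translate:
  fixes h :: "real \<Rightarrow> 'a::euclidean_space"
  assumes h: "\<And>x. h (x + 2 * pi) = h x" and i: "has_bochner_integral circle_measure h i"
  shows "has_bochner_integral circle_measure (\<lambda>t. h (t - s)) i"
proof -
  have per: "h (0 - (x + 2 * pi)) = h (0 - x)" for x
    using h[of "- x - 2 * pi"] by (simp add: algebra_simps)
  show ?thesis
    using has_bochner_integral_circle_reflect[where h = "\<lambda>s. h (0 - s)", OF per
        has_bochner_integral_circle_reflect[where h = h, OF h i], of s]
    by simp
qed

section \<open>Continuity of translation in \<open>L\<^sup>p\<close>\<close>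

lemma borel_measurable_reflect:
  fixes f :: "real \<Rightarrow> 'b::euclidean_space"
  assumes "f \<in> borel_measurable lebesgue"
  shows "(\<lambda>s. f (t - s)) \<in> borel_measurable lebesgue"
  using borel_measurable_affine[OF assms, of "-1" t] by simp

lemma borel_measurable_translate:
  fixes f :: "real \<Rightarrow> 'b::euclidean_space"
  assumes "f \<in> borel_measurable lebesgue"
  shows "(\<lambda>t. f (t - s)) \<in> borel_measurable lebesgue"
  using borel_measurable_affine[OF assms, of "1" "-s"] by simp

text \<open>A measurable function is an almost everywhere limit of continuous functions \<open>G n\<close>, which need not have any
  common integrable bound. Radial truncation at height \<open>m + 1\<close> is continuous and supplies one: dominated
  convergence first gives \<open>cut m \<circ> f \<rightarrow> f\<close> as \<open>m \<rightarrow> \<infinity>\<close>, where \<open>\<bar>f\<bar>\<^sup>p\<close> dominates, and then, for a fixed \<open>m\<close>,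
  \<open>cut m \<circ> G n \<rightarrow> cut m \<circ> f\<close>, where a constant dominates because \<open>S\<close> has finite measure.\<close>

lemma continuous_dense_in_Lp:
  fixes f :: "real \<Rightarrow> complex"
  assumes p: "1 \<le> p" and S: "S \<in> sets lebesgue" and f: "f \<in> borel_measurable lebesgue"
    and fin: "(\<integral>\<^sup>+t. ennreal (norm (f t) powr p) \<partial>lebesgue_on S) < \<infinity>"
    and finS: "emeasure lebesgue S < \<infinity>"
    and e: "0 < e"
  obtains g where "continuous_on UNIV g"
    "(\<integral>\<^sup>+t. ennreal (norm (f t - g t) powr p) \<partial>lebesgue_on S) < e"
proof -
  let ?M = "lebesgue_on S"
  define cut :: "nat \<Rightarrow> complex \<Rightarrow> complex" where "cut m z = z /\<^sub>R max 1 (norm z / (real m + 1))" for m z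
  have cut_cont: "continuous_on UNIV (cut m)" for m
    unfolding cut_def by (intro continuous_intros) auto
  have cut_norm: "norm (cut m z) \<le> real m + 1" for m z
  proof (cases "norm z / (real m + 1) \<le> 1")
    case True
    then show ?thesis by (simp add: cut_def field_simps)
  next
    case False
    then have "norm z > 0" by auto
    with False show ?thesis by (simp add: cut_def)
  qed
  have cut_diff: "norm (z - cut m z) \<le> norm z" for m z
  proof -
    define c where "c = 1 / max 1 (norm z / (real m + 1))"
    have c: "0 \<le> c" "c \<le> 1" by (auto simp: c_def)
    have "z - cut m z = (1 - c) *\<^sub>R z" by (simp add: cut_def c_def algebra_simps divide_inverse)
    then have "norm (z - cut m z) = (1 - c) * norm z" using c by simp
    also have "\<dots> \<le> 1 * norm z" using c by (intro mult_right_mono) auto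
    finally show ?thesis by simp
  qed
  have cut_eq: "eventually (\<lambda>m. cut m z = z) sequentially" for z
  proof -
    obtain N where "norm z \<le> real N" using real_arch_simple by blast
    then show ?thesis
      by (intro eventually_sequentiallyI[of N]) (auto simp: cut_def max_def field_simps)
  qed
  have fM[measurable]: "f \<in> borel_measurable ?M" using f by (rule measurable_restrict_space1)
  have cutM[measurable]: "cut m \<in> borel_measurable borel" for m
    using cut_cont by (rule borel_measurable_continuous_onI)
  have "(\<lambda>m. \<integral>\<^sup>+t. ennreal (norm (f t - cut m (f t)) powr p) \<partial>?M) \<longlonglongrightarrow> (\<integral>\<^sup>+t. 0 \<partial>?M)"
  proof (rule nn_integral_dominated_convergence)
    show "AE t in ?M. ennreal (norm (f t - cut m (f t)) powr p) \<le> ennreal (norm (f t) powr p)" for m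
      using p by (intro AE_I2 ennreal_leI powr_mono2 cut_diff) auto
    show "AE t in ?M. (\<lambda>m. ennreal (norm (f t - cut m (f t)) powr p)) \<longlonglongrightarrow> 0"
    proof (intro AE_I2 tendsto_eventually)
      show "\<forall>\<^sub>F m in sequentially. ennreal (norm (f t - cut m (f t)) powr p) = 0" for t
        using cut_eq[of "f t"] by eventually_elim simp
    qed
  qed (use fin in auto)
  define e' where "e' = e / ennreal (2 * 2 powr p)"
  have e': "0 < e'" using e by (simp add: e'_def ennreal_zero_less_divide)
  with \<open>_ \<longlonglongrightarrow> (\<integral>\<^sup>+t. 0 \<partial>?M)\<close>
  have "\<forall>\<^sub>F m in sequentially. (\<integral>\<^sup>+t. ennreal (norm (f t - cut m (f t)) powr p) \<partial>?M) < e'"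
    by (intro order_tendstoD) auto
  then obtain m where m: "(\<integral>\<^sup>+t. ennreal (norm (f t - cut m (f t)) powr p) \<partial>?M) < e'"
    by (auto simp: eventually_sequentially)
  obtain N G where N: "negligible N" and G: "\<And>n. continuous_on UNIV (G n)"
    and lim: "\<And>x. x \<notin> N \<Longrightarrow> (\<lambda>n. G n x) \<longlonglongrightarrow> f x"
    using f measurable_on_iff_borel_measurable[of UNIV f]
    unfolding measurable_on_def by (auto simp: lebesgue_on_UNIV_eq)
  have GM[measurable]: "G n \<in> borel_measurable ?M" for n
    using G by (intro measurable_restrict_space1 measurable_completion) (simp add: borel_measurable_continuous_onI)
  have "(\<lambda>n. \<integral>\<^sup>+t. ennreal (norm (cut m (f t) - cut m (G n t)) powr p) \<partial>?M) \<longlonglongrightarrow> (\<integral>\<^sup>+t. 0 \<partial>?M)"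
  proof (rule nn_integral_dominated_convergence)
    show "AE t in ?M. ennreal (norm (cut m (f t) - cut m (G n t)) powr p) \<le> ennreal ((2 * (real m + 1)) powr p)" for n
    proof (intro AE_I2 ennreal_leI powr_mono2)
      show "norm (cut m (f t) - cut m (G n t)) \<le> 2 * (real m + 1)" for t
        using order_trans[OF norm_triangle_ineq4 add_mono[OF cut_norm cut_norm]] by (simp only: mult_2)
    qed (use p in auto)
    have "AE t in lebesgue. t \<notin> N" using N by (intro AE_not_in) (simp add: negligible_iff_null_sets)
    then have "AE t in ?M. t \<notin> N" using S by (subst AE_restrict_space_iff) (auto elim: eventually_mono)
    then show "AE t in ?M. (\<lambda>n. ennreal (norm (cut m (f t) - cut m (G n t)) powr p)) \<longlonglongrightarrow> 0"
    proof eventually_elim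
      case (elim t)
      have "(\<lambda>n. cut m (G n t)) \<longlonglongrightarrow> cut m (f t)"
        using continuous_on_tendsto_compose[OF cut_cont lim[OF elim]] by simp
      then have "(\<lambda>n. norm (cut m (f t) - cut m (G n t)) powr p) \<longlonglongrightarrow> norm (cut m (f t) - cut m (f t)) powr p"
        using p by (intro tendsto_powr' tendsto_intros) auto
      then show ?case using p by (simp flip: ennreal_0)
    qed
    show "(\<integral>\<^sup>+ x. ennreal ((2 * (real m + 1)) powr p) \<partial>?M) < \<infinity>"
      using finS S by (simp add: emeasure_restrict_space ennreal_mult_less_top)
  qed auto
  with e' have "\<forall>\<^sub>F n in sequentially. (\<integral>\<^sup>+t. ennreal (norm (cut m (f t) - cut m (G n t)) powr p) \<partial>?M) < e'"
    by (intro order_tendstoD) auto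
  then obtain n where n: "(\<integral>\<^sup>+t. ennreal (norm (cut m (f t) - cut m (G n t)) powr p) \<partial>?M) < e'"
    by (auto simp: eventually_sequentially)
  show thesis
  proof
    show "continuous_on UNIV (\<lambda>t. cut m (G n t))"
      by (rule continuous_on_compose2[OF cut_cont G]) auto
    have "(\<integral>\<^sup>+t. ennreal (norm (f t - cut m (G n t)) powr p) \<partial>?M)
      \<le> (\<integral>\<^sup>+t. ennreal (2 powr p) * (ennreal (norm (f t - cut m (f t)) powr p)
           + ennreal (norm (cut m (f t) - cut m (G n t)) powr p)) \<partial>?M)"
    proof (rule nn_integral_mono)
      fix t
      show "ennreal (norm (f t - cut m (G n t)) powr p) \<le> ennreal (2 powr p) * (ennreal (norm (f t - cut m (f t)) powr p)
           + ennreal (norm (cut m (f t) - cut m (G n t)) powr p))"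
        using norm_add_powr_le[of p "f t - cut m (f t)" "cut m (f t) - cut m (G n t)"] p
        by (simp flip: ennreal_mult ennreal_plus add: ennreal_leI)
    qed
    also have "\<dots> = ennreal (2 powr p) * ((\<integral>\<^sup>+t. ennreal (norm (f t - cut m (f t)) powr p) \<partial>?M)
           + (\<integral>\<^sup>+t. ennreal (norm (cut m (f t) - cut m (G n t)) powr p) \<partial>?M))"
      by (simp add: nn_integral_cmult nn_integral_add)
    also have "\<dots> < ennreal (2 powr p) * (e' + e')"
      using m n by (intro ennreal_mult_strict_left_mono add_strict_mono) auto
    also have "\<dots> = ennreal (2 * 2 powr p) * e'"
      by (simp add: ennreal_mult mult.left_commute mult.assoc flip: mult_2)
    also have "\<dots> = e"
      unfolding e'_def
      by (subst ennreal_times_divide, subst mult.commute[of _ e], rule ennreal_mult_divide_eq) auto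
    finally show "(\<integral>\<^sup>+t. ennreal (norm (f t - cut m (G n t)) powr p) \<partial>?M) < e" .
  qed
qed

text \<open>For a continuous function this is uniform continuity, and a translate of \<open>f\<close> is
  approximated by the translate of a continuous \<open>g\<close> as well as \<open>f\<close> is by \<open>g\<close>. Since \<open>g\<close> need not be periodic, the error is controlled on
  an interval that contains every translate of the base period that occurs.\<close>

lemma translation_continuous_in_Lp:
  fixes f :: "real \<Rightarrow> complex"
  assumes p: "1 \<le> p" and per: "\<And>x. f (x + 2 * pi) = f x" and f: "f \<in> borel_measurable lebesgue"
    and fin: "integrable circle_measure (\<lambda>t. norm (f t) powr p)"
    and e: "0 < (e::real)"
  shows "\<exists>d>0. \<forall>s. \<bar>s\<bar> \<le> d \<longrightarrow> (\<integral>\<^sup>+t. ennreal (norm (f (t - s) - f t) powr p) \<partial>circle_measure) \<le> ennreal e"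
proof -
  \<comment> \<open>Two periods contain every translate of the base period by at most \<open>1\<close>.\<close>
  define J where "J = {-2*pi..<2*pi}"
  let ?J = "lebesgue_on J"
  have J[measurable]: "J \<in> sets lebesgue" by (simp add: J_def)
  have "has_bochner_integral lebesgue (\<lambda>x. indicator {a..<a + 2 * pi} x *\<^sub>R (norm (f x) powr p))
      (LINT t|circle_measure. norm (f t) powr p)" for a
    using has_bochner_integral_period_interval[of "\<lambda>x. norm (f x) powr p" "-pi"] per
      has_bochner_integral_integrable[OF fin] unfolding has_bochner_integral_circle_iff by simp
  then have fin_a: "integrable lebesgue (\<lambda>x. indicator {a..<a + 2 * pi} x *\<^sub>R (norm (f x) powr p))" for a
    using has_bochner_integral_iff by blast
  have "integrable lebesgue (\<lambda>x. indicator {-2*pi..<-2*pi + 2 * pi} x *\<^sub>R (norm (f x) powr p)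
      + indicator {0..<0 + 2 * pi} x *\<^sub>R (norm (f x) powr p))"
    by (intro Bochner_Integration.integrable_add fin_a)
  also have "(\<lambda>x. indicator {-2*pi..<-2*pi + 2 * pi} x *\<^sub>R (norm (f x) powr p)
      + indicator {0..<0 + 2 * pi} x *\<^sub>R (norm (f x) powr p)) = (\<lambda>x. indicator J x *\<^sub>R (norm (f x) powr p))"
    by (auto simp: J_def fun_eq_iff indicator_def)
  finally have "integrable ?J (\<lambda>t. norm (f t) powr p)"
    by (subst integrable_restrict_space) auto
  then have finJ: "(\<integral>\<^sup>+t. ennreal (norm (f t) powr p) \<partial>?J) < \<infinity>"
    by (simp add: integrable_iff_bounded)
  \<comment> \<open>The approximation error enters twice, each time with the factor \<open>2\<^sup>p 2\<^sup>p\<close>, and \<open>\<eta>\<^sup>p\<close> is integrated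
    over length \<open>2\<pi>\<close> with the factor \<open>2\<^sup>p\<close>; the choices make both contributions \<open>e / 2\<close>.\<close>
  define e1 where "e1 = e / (4 * (2 powr p * 2 powr p))"
  have e1: "e1 > 0" using e by (simp add: e1_def)
  obtain g where g: "continuous_on UNIV g"
    and fg: "(\<integral>\<^sup>+t. ennreal (norm (f t - g t) powr p) \<partial>?J) < ennreal e1"
    by (rule continuous_dense_in_Lp[OF p J f finJ, of "ennreal e1"]) (use e1 in \<open>auto simp: J_def\<close>)
  define \<eta> where "\<eta> = (e / (4 * pi * 2 powr p)) powr (1 / p)"
  have \<eta>: "\<eta> > 0" "\<eta> powr p = e / (4 * pi * 2 powr p)"
    using e p by (auto simp: \<eta>_def powr_powr)
  have "uniformly_continuous_on {-2*pi..2*pi} g"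
    using g by (intro compact_uniformly_continuous) (auto intro: continuous_on_subset)
  then obtain d0 where d0: "d0 > 0" and
    uc: "\<And>x y. x \<in> {-2*pi..2*pi} \<Longrightarrow> y \<in> {-2*pi..2*pi} \<Longrightarrow> dist x y < d0 \<Longrightarrow> dist (g x) (g y) < \<eta>"
    unfolding uniformly_continuous_on_def using \<eta>(1) by metis
  define d where "d = min (d0 / 2) 1"
  have gM: "g \<in> borel_measurable lebesgue"
    using g by (intro measurable_completion) (simp add: borel_measurable_continuous_onI)
  define h where "h t = f t - g t" for t
  have h: "h \<in> borel_measurable lebesgue" unfolding h_def using f gM by auto
  have hJ: "(\<integral>\<^sup>+t. ennreal (norm (h (t - s)) powr p) \<partial>circle_measure) \<le> ennreal e1" if s: "\<bar>s\<bar> \<le> 1" for s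
  proof -
    have "(\<integral>\<^sup>+t. ennreal (norm (h (t - s)) powr p) \<partial>circle_measure)
        = (\<integral>\<^sup>+t. ennreal (norm (h (t - s)) powr p) * indicator {-pi..pi} t \<partial>lebesgue)"
      by (simp add: nn_integral_restrict_space)
    also have "\<dots> \<le> (\<integral>\<^sup>+t. ennreal (norm (h (-s + 1 * t)) powr p) * indicator J (-s + 1 * t) \<partial>lebesgue)"
      using s pi_gt3 by (intro nn_integral_mono) (auto simp: J_def indicator_def)
    also have "\<dots> = (\<integral>\<^sup>+t. ennreal (norm (h t) powr p) * indicator J t \<partial>lebesgue)"
      using h by (subst nn_integral_real_affine_lebesgue[where c = 1 and t = "-s"]) auto
    also have "\<dots> = (\<integral>\<^sup>+t. ennreal (norm (f t - g t) powr p) \<partial>?J)"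
      by (simp add: nn_integral_restrict_space h_def)
    finally show ?thesis using fg by simp
  qed
  show ?thesis
  proof (intro exI conjI allI impI)
    show "d > 0" using d0 by (simp add: d_def)
    fix s assume s: "\<bar>s\<bar> \<le> d"
    then have s1: "\<bar>s\<bar> \<le> 1" by (simp add: d_def)
    have hsM[measurable]: "(\<lambda>t. h (t - s)) \<in> borel_measurable circle_measure" "h \<in> borel_measurable circle_measure"
      using h borel_measurable_translate[OF h] by (auto intro: measurable_restrict_space1)
    have "(\<integral>\<^sup>+t. ennreal (norm (f (t - s) - f t) powr p) \<partial>circle_measure)
      \<le> (\<integral>\<^sup>+t. ennreal (2 powr p * 2 powr p) * (ennreal (norm (h (t - s)) powr p) + ennreal (norm (h (t - 0)) powr p))
            + ennreal (2 powr p * \<eta> powr p) \<partial>circle_measure)"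
    proof (rule nn_integral_mono)
      fix t assume "t \<in> space circle_measure"
      then have t: "t \<in> {-pi..pi}" by simp
      have "dist (g (t - s)) (g t) < \<eta>"
        using t s d0 pi_gt3 by (intro uc) (auto simp: d_def dist_real_def)
      then have "norm (g (t - s) - g t) powr p \<le> \<eta> powr p"
        using p by (intro powr_mono2) (auto simp: dist_norm)
      moreover have "norm ((h (t - s) - h t) + (g (t - s) - g t)) powr p
          \<le> 2 powr p * (norm (h (t - s) - h t) powr p + norm (g (t - s) - g t) powr p)"
        using p by (intro norm_add_powr_le) auto
      moreover have "norm (h (t - s) - h t) powr p \<le> 2 powr p * (norm (h (t - s)) powr p + norm (h t) powr p)"
        using p by (intro norm_diff_powr_le) auto
      ultimately have "norm ((h (t - s) - h t) + (g (t - s) - g t)) powr p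
          \<le> 2 powr p * (2 powr p * (norm (h (t - s)) powr p + norm (h t) powr p) + \<eta> powr p)"
        by (smt (verit) mult_left_mono powr_ge_zero)
      also have "(h (t - s) - h t) + (g (t - s) - g t) = f (t - s) - f t" by (simp add: h_def)
      finally show "ennreal (norm (f (t - s) - f t) powr p)
          \<le> ennreal (2 powr p * 2 powr p) * (ennreal (norm (h (t - s)) powr p) + ennreal (norm (h (t - 0)) powr p))
            + ennreal (2 powr p * \<eta> powr p)"
        by (simp flip: ennreal_mult ennreal_plus add: ennreal_leI algebra_simps)
    qed
    also have "\<dots> = ennreal (2 powr p * 2 powr p) * ((\<integral>\<^sup>+t. ennreal (norm (h (t - s)) powr p) \<partial>circle_measure)
          + (\<integral>\<^sup>+t. ennreal (norm (h (t - 0)) powr p) \<partial>circle_measure)) + ennreal (2 powr p * \<eta> powr p) * ennreal (2 * pi)"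
      by (simp add: nn_integral_add nn_integral_cmult emeasure_restrict_space)
    also have "\<dots> \<le> ennreal (2 powr p * 2 powr p) * (ennreal e1 + ennreal e1) + ennreal (2 powr p * \<eta> powr p) * ennreal (2 * pi)"
      using hJ[OF s1] hJ[of 0] by (intro add_mono mult_left_mono) auto
    also have "\<dots> = ennreal (2 powr p * 2 powr p * (e1 + e1) + 2 powr p * \<eta> powr p * (2 * pi))"
      using e1 by (simp flip: ennreal_mult ennreal_plus)
    also have "2 powr p * 2 powr p * (e1 + e1) + 2 powr p * \<eta> powr p * (2 * pi) = e"
      using p by (simp add: e1_def \<eta>(2) field_simps)
    finally show "(\<integral>\<^sup>+t. ennreal (norm (f (t - s) - f t) powr p) \<partial>circle_measure) \<le> ennreal e" .
  qed
qed

section \<open>Concentration of summability kernels\<close>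

lemma summability_kernelD:
  assumes "summability_kernel k"
  shows "\<And>x. k n (x + 2 * pi) = k n x" "k n \<in> borel_measurable lebesgue"
    "integrable circle_measure (k n)" "(LINT t|circle_measure. k n t) = complex_of_real (2 * pi)"
proof -
  have k: "k n \<in> Lp_circle 1" and i: "complex_of_real (1 / (2 * pi)) * (LINT t:{-pi..pi}|lebesgue. k n t) = 1"
    using assms unfolding summability_kernel_def by auto
  from k show "\<And>x. k n (x + 2 * pi) = k n x" and M: "k n \<in> borel_measurable lebesgue"
    by (auto simp: Lp_circle_def periodic_2pi_def)
  have "integrable circle_measure (\<lambda>t. norm (k n t))"
    using k by (simp add: Lp_circle_def set_integrable_def integrable_restrict_space)
  with M show "integrable circle_measure (k n)"
    by (subst (asm) integrable_norm_iff) (auto intro: measurable_restrict_space1)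
  have "(LINT t|circle_measure. k n t) = (LINT t:{-pi..pi}|lebesgue. k n t)"
    by (simp add: integral_restrict_space set_lebesgue_integral_def)
  with i show "(LINT t|circle_measure. k n t) = complex_of_real (2 * pi)"
    by (simp add: field_simps)
qed

lemma summability_kernel_L1_bounded:
  assumes "summability_kernel k"
  obtains C where "1 \<le> C" "\<And>n. (LINT t|circle_measure. norm (k n t)) \<le> C"
proof -
  obtain C where C: "\<And>n. 1 / (2 * pi) * (LINT t:{-pi..pi}|lebesgue. norm (k n t)) \<le> C"
    using assms unfolding summability_kernel_def bdd_above_def by auto
  show thesis
  proof
    show "(LINT t|circle_measure. norm (k n t)) \<le> max 1 (2 * pi * C)" for n
      using C[of n] by (simp add: integral_restrict_space set_lebesgue_integral_def field_simps max_def)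
  qed simp
qed

text \<open>The concentration of the kernel at \<open>0\<close> in a form that serves both function spaces. A weight that is small near \<open>0\<close>
  is small on a fixed neighbourhood of \<open>0\<close>, where the mass of \<open>k n\<close> is bounded in \<open>n\<close>, and it is bounded by \<open>B\<close> on
  the rest of the circle, where the mass of \<open>k n\<close> vanishes in the limit. The bound is uniform over a family \<open>W\<close> of weights: uniform convergence needs one
  weight for each point of the circle, convergence in \<open>L\<^sup>p\<close> a single one.\<close>

lemma summability_kernel_uniform_decay:
  fixes k :: "nat \<Rightarrow> real \<Rightarrow> complex" and W :: "(real \<Rightarrow> ennreal) set"
  assumes k: "summability_kernel k"
    and small: "\<And>e. 0 < (e::real) \<Longrightarrow> \<exists>d>0. \<forall>w\<in>W. \<forall>s. \<bar>s\<bar> \<le> d \<longrightarrow> w s \<le> ennreal e"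
    and bdd: "\<And>w s. w \<in> W \<Longrightarrow> w s \<le> ennreal B" and B: "0 \<le> B"
    and e: "0 < (e::real)"
  shows "\<forall>\<^sub>F n in sequentially. \<forall>w\<in>W.
    (\<integral>\<^sup>+s. ennreal (norm (k n s)) * w s \<partial>circle_measure) \<le> ennreal e"
proof -
  obtain C where C: "1 \<le> C" "\<And>n. (LINT t|circle_measure. norm (k n t)) \<le> C"
    using summability_kernel_L1_bounded[OF k] by blast
  define \<eta> where "\<eta> = e / (2 * C)"
  have \<eta>: "0 < \<eta>" using e C(1) by (simp add: \<eta>_def)
  obtain d0 where d0: "0 < d0" "\<And>w s. w \<in> W \<Longrightarrow> \<bar>s\<bar> \<le> d0 \<Longrightarrow> w s \<le> ennreal \<eta>"
    using small[OF \<eta>] by blast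
  define d where "d = min d0 1"
  have d: "0 < d" "d < pi" using d0 pi_gt3 by (auto simp: d_def)
  define F where "F = {t::real. d < \<bar>t\<bar> \<and> \<bar>t\<bar> < pi}"
  have F: "F \<in> sets lebesgue"
  proof -
    have "F = {-pi<..<-d} \<union> {d<..<pi}" using d by (auto simp: F_def)
    then show ?thesis by simp
  qed
  have F_sub: "F \<subseteq> {-pi..pi}" by (auto simp: F_def)
  have "(\<lambda>n. LINT t:F|lebesgue. norm (k n t)) \<longlonglongrightarrow> 0"
    using k d unfolding summability_kernel_def F_def by blast
  then have "\<forall>\<^sub>F n in sequentially. (LINT t:F|lebesgue. norm (k n t)) < e / (2 * (B + 1))"
    using e B by (intro order_tendstoD) auto
  then show ?thesis
  proof eventually_elim
    case (elim n)
    have kI: "integrable circle_measure (\<lambda>s. norm (k n s))"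
      using summability_kernelD(3)[OF k] by (rule integrable_norm)
    have kM[measurable]: "k n \<in> borel_measurable circle_measure"
      using summability_kernelD(3)[OF k] by (rule borel_measurable_integrable)
    have FM[measurable]: "F \<in> sets circle_measure"
      using F F_sub by (simp add: sets_restrict_space_iff)
    have "(LINT t:F|lebesgue. norm (k n t)) = (LINT t|circle_measure. indicator F t * norm (k n t))"
      unfolding integral_restrict_space[of "{-pi..pi}" lebesgue, simplified] set_lebesgue_integral_def
      using F_sub by (intro Bochner_Integration.integral_cong) (auto simp: indicator_def)
    moreover have FI: "integrable circle_measure (\<lambda>t. indicator F t * norm (k n t))"
      using integrable_mult_indicator[OF FM kI] by simp
    moreover have "(\<integral>\<^sup>+t. ennreal (norm (k n t)) * indicator F t \<partial>circle_measure)
        = (\<integral>\<^sup>+t. ennreal (indicator F t * norm (k n t)) \<partial>circle_measure)"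
      by (intro nn_integral_cong) (auto simp: indicator_def)
    ultimately have F_int: "(\<integral>\<^sup>+t. ennreal (norm (k n t)) * indicator F t \<partial>circle_measure)
        = ennreal (LINT t:F|lebesgue. norm (k n t))"
      using nn_integral_eq_integral[OF FI] by simp
    have ends: "AE s in circle_measure. s \<notin> {-pi, pi}"
      by (subst AE_restrict_space_iff) (auto intro: AE_mp[OF AE_not_in[of "{-pi, pi}"]])
    show ?case
    proof
      fix w assume w: "w \<in> W"
      have "(\<integral>\<^sup>+s. ennreal (norm (k n s)) * w s \<partial>circle_measure)
        \<le> (\<integral>\<^sup>+s. ennreal \<eta> * ennreal (norm (k n s)) + ennreal B * (ennreal (norm (k n s)) * indicator F s) \<partial>circle_measure)"
      proof (rule nn_integral_mono_AE)
        show "AE s in circle_measure. ennreal (norm (k n s)) * w s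
          \<le> ennreal \<eta> * ennreal (norm (k n s)) + ennreal B * (ennreal (norm (k n s)) * indicator F s)"
          using ends AE_space
        proof eventually_elim
          case (elim s)
          show ?case
          proof (cases "\<bar>s\<bar> \<le> d")
            case True
            then have "w s \<le> ennreal \<eta>" using d0 w by (auto simp: d_def)
            then have "ennreal (norm (k n s)) * w s \<le> ennreal \<eta> * ennreal (norm (k n s))"
              by (subst mult.commute) (intro mult_right_mono, auto)
            then show ?thesis by (rule order_trans) simp
          next
            case False
            then have "s \<in> F" using elim by (auto simp: F_def)
            moreover have "ennreal (norm (k n s)) * w s \<le> ennreal B * ennreal (norm (k n s))"
              using bdd[OF w] by (subst mult.commute) (intro mult_right_mono, auto)
            ultimately show ?thesis by (auto intro: order_trans)
          qed
        qed
      qed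
      also have "\<dots> = ennreal \<eta> * ennreal (LINT t|circle_measure. norm (k n t))
          + ennreal B * ennreal (LINT t:F|lebesgue. norm (k n t))"
        by (simp add: nn_integral_add nn_integral_cmult F_int nn_integral_eq_integral[OF kI])
      also have "\<dots> \<le> ennreal \<eta> * ennreal C + ennreal B * ennreal (e / (2 * (B + 1)))"
        using C elim by (intro add_mono mult_left_mono ennreal_leI) auto
      also have "\<dots> = ennreal (\<eta> * C + B * (e / (2 * (B + 1))))"
        using \<eta> C(1) e B by (simp flip: ennreal_mult ennreal_plus)
      also have "\<dots> \<le> ennreal e"
      proof (rule ennreal_leI)
        have "\<eta> * C = e / 2" using C(1) by (simp add: \<eta>_def)
        moreover have "B * (e / (2 * (B + 1))) \<le> e / 2" using B e by (simp add: field_simps)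
        ultimately show "\<eta> * C + B * (e / (2 * (B + 1))) \<le> e" by linarith
      qed
      finally show "(\<integral>\<^sup>+s. ennreal (norm (k n s)) * w s \<partial>circle_measure) \<le> ennreal e" .
    qed
  qed
qed

section \<open>Convolution as an average of translates\<close>

text \<open>Commutativity of convolution: the translation now acts on \<open>f\<close>, where it can be compared with \<open>f t\<close>.\<close>

lemma conv_circle_eq:
  assumes k: "\<And>x. k (x + 2 * pi) = k x" and f: "\<And>x. f (x + 2 * pi) = f x"
  shows "conv_circle k f t = complex_of_real (1 / (2 * pi)) * (LINT s|circle_measure. k s * f (t - s))"
proof -
  have per: "k (x + 2 * pi) * f (t - (x + 2 * pi)) = k x * f (t - x)" for x
    using k f[of "t - x - 2 * pi"] by (simp add: algebra_simps)
  have "(LINT s:{-pi..pi}|lebesgue. k (t - s) * f s) = (LINT s|circle_measure. k (t - s) * f (t - (t - s)))"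
    by (simp add: integral_restrict_space set_lebesgue_integral_def)
  also have "\<dots> = (LINT s|circle_measure. k s * f (t - s))"
    by (rule integral_circle_reflect[where h = "\<lambda>s. k s * f (t - s)", OF per])
  finally show ?thesis by (simp add: conv_circle_def)
qed

lemma conv_circle_periodic:
  assumes k: "\<And>x. k (x + 2 * pi) = k x"
  shows "conv_circle k f (t + 2 * pi) = conv_circle k f t"
proof -
  have "k (t + 2 * pi - s) = k (t - s)" for s using k[of "t - s"] by (simp add: algebra_simps)
  then show ?thesis by (simp add: conv_circle_def)
qed

text \<open>Since \<open>k\<close> has mean \<open>1\<close>, the value \<open>f t\<close> is itself an average against \<open>k\<close>.\<close>

lemma conv_circle_minus:
  assumes k: "\<And>x. k (x + 2 * pi) = k x" and f: "\<And>x. f (x + 2 * pi) = f x"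
    and kI: "integrable circle_measure k" "(LINT t|circle_measure. k t) = complex_of_real (2 * pi)"
    and I: "integrable circle_measure (\<lambda>s. k s * (f (t - s) - f t))"
  shows "conv_circle k f t - f t
      = complex_of_real (1 / (2 * pi)) * (LINT s|circle_measure. k s * (f (t - s) - f t))"
proof -
  have "(LINT s|circle_measure. k s * (f (t - s) - f t) + k s * f t)
      = (LINT s|circle_measure. k s * (f (t - s) - f t)) + complex_of_real (2 * pi) * f t"
    using kI I by simp
  then have "(LINT s|circle_measure. k s * f (t - s))
      = (LINT s|circle_measure. k s * (f (t - s) - f t)) + complex_of_real (2 * pi) * f t"
    by (simp add: algebra_simps)
  then show ?thesis
    by (simp add: conv_circle_eq[of k f, OF k f] algebra_simps)
qed

section \<open>Measurability and interchange of integrals\<close>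

lemma AE_circle_measure:
  assumes "AE x in lebesgue. P x"
  shows "AE x in circle_measure. P x"
  using assms by (subst AE_restrict_space_iff) (auto elim: eventually_mono)

lemma AE_lebesgue_affine:
  fixes c t :: real
  assumes "AE x in lebesgue. P x" "c \<noteq> 0"
  shows "AE x in lebesgue. P (t + c * x)"
proof -
  have "AE x in lborel. P x" using assms(1) by (simp add: AE_completion_iff)
  then obtain N where N: "{x \<in> space lborel. \<not> P x} \<subseteq> N" "emeasure lborel N = 0" "N \<in> sets lborel"
    by (rule AE_E)
  have "AE x in lborel. x \<notin> N" using N by (intro AE_not_in) auto
  then have "AE x in lborel. t + c * x \<notin> N"
    using N assms(2) by (intro AE_borel_affine) auto
  then have "AE x in lborel. P (t + c * x)" by eventually_elim (use N in auto)
  then show ?thesis by (rule AE_completion)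
qed

text \<open>The function \<open>(t, s) \<mapsto> f (t - s)\<close> is measurable for the product \<open>\<sigma>\<close>-algebra when \<open>f\<close> is Borel, but in general not
  when \<open>f\<close> is only Lebesgue measurable. A Borel representative of \<open>f\<close> leaves the integrals over \<open>s\<close> unchanged, because affine maps preserve null sets.\<close>

lemma borel_representative:
  fixes f :: "real \<Rightarrow> complex"
  assumes "f \<in> borel_measurable lebesgue"
  obtains f' where "f' \<in> borel_measurable borel" "AE x in lebesgue. f x = f' x"
proof -
  have "(\<lambda>x. Re (f x)) \<in> borel_measurable lebesgue" "(\<lambda>x. Im (f x)) \<in> borel_measurable lebesgue"
    using assms by auto
  from this[THEN completion_ex_borel_measurable_real] obtain u v
    where uv: "u \<in> borel_measurable lborel" "v \<in> borel_measurable lborel"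
      "AE x in lborel. Re (f x) = u x" "AE x in lborel. Im (f x) = v x"
    by blast
  then have [measurable]: "u \<in> borel_measurable borel" "v \<in> borel_measurable borel" by auto
  show thesis
  proof
    show "(\<lambda>x. complex_of_real (u x) + \<i> * complex_of_real (v x)) \<in> borel_measurable borel"
      by measurable
    have "AE x in lborel. f x = complex_of_real (u x) + \<i> * complex_of_real (v x)"
      using uv(3,4) by eventually_elim (simp add: complex_eq_iff)
    then show "AE x in lebesgue. f x = complex_of_real (u x) + \<i> * complex_of_real (v x)"
      by (rule AE_completion)
  qed
qed

text \<open>Borel representatives of \<open>k\<close> and \<open>f\<close> give the same convolution at every point, so the result is even Borel measurable.\<close>

lemma conv_circle_measurable:
  assumes k: "k \<in> borel_measurable lebesgue" and f: "f \<in> borel_measurable lebesgue"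
  shows "conv_circle k f \<in> borel_measurable borel"
proof -
  obtain k' where k'[measurable]: "k' \<in> borel_measurable borel" and kk: "AE x in lebesgue. k x = k' x"
    using borel_representative[OF k] by blast
  obtain f' where f'[measurable]: "f' \<in> borel_measurable borel" and ff: "AE x in lebesgue. f x = f' x"
    using borel_representative[OF f] by blast
  have "(LINT s:{-pi..pi}|lebesgue. k (t - s) * f s) = (LINT s|lborel. indicator {-pi..pi} s *\<^sub>R (k' (t - s) * f' s))" for t
  proof -
    have "AE s in lebesgue. k (t + (-1) * s) = k' (t + (-1) * s)"
      by (rule AE_lebesgue_affine[OF kk]) simp
    with ff have "AE s in lebesgue. indicator {-pi..pi} s *\<^sub>R (k (t - s) * f s)
        = indicator {-pi..pi} s *\<^sub>R (k' (t - s) * f' s)"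
      by eventually_elim simp
    moreover have "(\<lambda>s. indicator {-pi..pi} s *\<^sub>R (k (t - s) * f s)) \<in> borel_measurable lebesgue"
      using borel_measurable_reflect[OF k, of t] f
      by (intro borel_measurable_scaleR borel_measurable_indicator borel_measurable_times) auto
    moreover have [measurable]: "(\<lambda>s. indicator {-pi..pi} s *\<^sub>R (k' (t - s) * f' s)) \<in> borel_measurable lborel"
      by measurable
    ultimately have "(LINT s|lebesgue. indicator {-pi..pi} s *\<^sub>R (k (t - s) * f s))
        = (LINT s|lebesgue. indicator {-pi..pi} s *\<^sub>R (k' (t - s) * f' s))"
      by (intro integral_cong_AE) (auto intro: measurable_completion)
    then show ?thesis
      by (simp add: set_lebesgue_integral_def integral_completion)
  qed
  then have "conv_circle k f = (\<lambda>t. complex_of_real (1 / (2 * pi)) *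
      (LINT s|lborel. indicator {-pi..pi} s *\<^sub>R (k' (t - s) * f' s)))"
    by (simp add: fun_eq_iff conv_circle_def)
  also have "\<dots> \<in> borel_measurable borel"
    by measurable
  finally show ?thesis .
qed

text \<open>With Borel representatives the integrand is measurable on the product. It changes under this replacement only for \<open>t\<close>
  or \<open>s\<close> in a null set, or for almost no value of the inner variable, so both iterated integrals stay the same. The second claim is what
  makes an almost everywhere statement out of the finiteness of the double integral.\<close>

lemma tonelli_convolution_difference:
  fixes k f :: "real \<Rightarrow> complex" and p :: real
  assumes k: "k \<in> borel_measurable lebesgue" and f: "f \<in> borel_measurable lebesgue"
  defines "F \<equiv> \<lambda>t s. ennreal (norm (k s)) * ennreal (norm (f (t - s) - f t) powr p)"
  shows "(\<integral>\<^sup>+t. (\<integral>\<^sup>+s. F t s \<partial>circle_measure) \<partial>circle_measure)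
       = (\<integral>\<^sup>+s. (\<integral>\<^sup>+t. F t s \<partial>circle_measure) \<partial>circle_measure)" (is "?l = ?r")
    and "\<exists>D. D \<in> borel_measurable circle_measure \<and>
      (AE t in circle_measure. (\<integral>\<^sup>+s. F t s \<partial>circle_measure) = D t)"
proof -
  obtain k' where k'[measurable]: "k' \<in> borel_measurable borel" and kk: "AE x in lebesgue. k x = k' x"
    using borel_representative[OF k] by blast
  obtain f' where f'[measurable]: "f' \<in> borel_measurable borel" and ff: "AE x in lebesgue. f x = f' x"
    using borel_representative[OF f] by blast
  define F' where "F' t s = ennreal (norm (k' s)) * ennreal (norm (f' (t - s) - f' t) powr p)" for t s
  define L where "L = restrict_space lborel {-pi..pi}"
  have circ_L: "integral\<^sup>N circle_measure g = integral\<^sup>N L g" for g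
    by (simp add: L_def nn_integral_restrict_space nn_integral_completion)
  interpret L: sigma_finite_measure L
    unfolding L_def by (rule sigma_finite_measure_restrict_space) (auto intro: sigma_finite_lborel)
  interpret LL: pair_sigma_finite L L ..
  have idL[measurable]: "(\<lambda>x. x) \<in> measurable L borel"
    unfolding L_def by (rule measurable_restrict_space1) simp
  have [measurable]: "fst \<in> borel_measurable (L \<Otimes>\<^sub>M L)" "snd \<in> borel_measurable (L \<Otimes>\<^sub>M L)"
    using measurable_compose[OF measurable_fst idL] measurable_compose[OF measurable_snd idL] by auto
  have [measurable]: "snd \<in> borel_measurable (borel \<Otimes>\<^sub>M L)"
    using measurable_compose[OF measurable_snd idL] by simp
  have "case_prod F' \<in> borel_measurable (borel \<Otimes>\<^sub>M L)"
    unfolding F'_def case_prod_beta by measurable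
  then have "(\<lambda>t. \<integral>\<^sup>+s. F' t s \<partial>L) \<in> borel_measurable borel"
    by (rule L.borel_measurable_nn_integral)
  then have DM: "(\<lambda>t. \<integral>\<^sup>+s. F' t s \<partial>L) \<in> borel_measurable circle_measure"
    by (intro measurable_restrict_space1 measurable_completion) simp
  have F'M': "(\<lambda>(s, t). F' t s) \<in> borel_measurable (L \<Otimes>\<^sub>M L)"
    unfolding F'_def case_prod_beta by measurable
  have in_s: "(\<integral>\<^sup>+s. F t s \<partial>circle_measure) = (\<integral>\<^sup>+s. F' t s \<partial>L)" if t: "f t = f' t" for t
  proof -
    have "AE s in lebesgue. f (t + (-1) * s) = f' (t + (-1) * s)"
      by (rule AE_lebesgue_affine[OF ff]) simp
    with kk have "AE s in lebesgue. F t s = F' t s"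
      by eventually_elim (simp add: F_def F'_def t)
    then show ?thesis unfolding circ_L[symmetric]
      by (intro nn_integral_cong_AE AE_circle_measure)
  qed
  have in_t: "(\<integral>\<^sup>+t. F t s \<partial>circle_measure) = (\<integral>\<^sup>+t. F' t s \<partial>L)" if s: "k s = k' s" for s
  proof -
    have "AE t in lebesgue. f (-s + 1 * t) = f' (-s + 1 * t)"
      by (rule AE_lebesgue_affine[OF ff]) simp
    with ff have "AE t in lebesgue. F t s = F' t s"
      by eventually_elim (simp add: F_def F'_def s)
    then show ?thesis unfolding circ_L[symmetric]
      by (intro nn_integral_cong_AE AE_circle_measure)
  qed
  have AE_s: "AE t in circle_measure. (\<integral>\<^sup>+s. F t s \<partial>circle_measure) = (\<integral>\<^sup>+s. F' t s \<partial>L)"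
    using AE_circle_measure[OF ff] by eventually_elim (rule in_s)
  have AE_t: "AE s in circle_measure. (\<integral>\<^sup>+t. F t s \<partial>circle_measure) = (\<integral>\<^sup>+t. F' t s \<partial>L)"
    using AE_circle_measure[OF kk] by eventually_elim (rule in_t)
  have l: "?l = (\<integral>\<^sup>+t. (\<integral>\<^sup>+s. F' t s \<partial>L) \<partial>L)"
    unfolding nn_integral_cong_AE[OF AE_s] by (rule circ_L)
  have r: "?r = (\<integral>\<^sup>+s. (\<integral>\<^sup>+t. F' t s \<partial>L) \<partial>L)"
    unfolding nn_integral_cong_AE[OF AE_t] by (rule circ_L)
  show "?l = ?r" unfolding l r by (rule LL.Fubini'[OF F'M'])
  show "\<exists>D. D \<in> borel_measurable circle_measure \<and>
      (AE t in circle_measure. (\<integral>\<^sup>+s. F t s \<partial>circle_measure) = D t)"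
    using AE_s DM by (intro exI[of _ "\<lambda>t. \<integral>\<^sup>+s. F' t s \<partial>L"]) simp
qed

section \<open>Estimates for the approximation error\<close>

lemma Lp_circle_iff:
  "f \<in> Lp_circle p \<longleftrightarrow> (\<forall>x. f (x + 2 * pi) = f x) \<and> f \<in> borel_measurable lebesgue \<and>
     integrable circle_measure (\<lambda>t. norm (f t) powr p)"
  by (simp add: Lp_circle_def periodic_2pi_def set_integrable_def integrable_restrict_space)

lemma C_circle_iff: "f \<in> C_circle \<longleftrightarrow> (\<forall>x. f (x + 2 * pi) = f x) \<and> continuous_on UNIV f"
  by (simp add: C_circle_def periodic_2pi_def)

lemma translation_difference_Lp_bounded:
  assumes p: "1 \<le> p" and f: "f \<in> Lp_circle p"
  shows "(\<integral>\<^sup>+t. ennreal (norm (f (t - s) - f t) powr p) \<partial>circle_measure)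
    \<le> ennreal (2 powr p * (2 * (LINT t|circle_measure. norm (f t) powr p)))"
proof -
  let ?N = "LINT t|circle_measure. norm (f t) powr p"
  from f have per: "\<And>x. norm (f (x + 2 * pi)) powr p = norm (f x) powr p"
    and int: "integrable circle_measure (\<lambda>t. norm (f t) powr p)" by (auto simp: Lp_circle_iff)
  have shift: "has_bochner_integral circle_measure (\<lambda>t. norm (f (t - s)) powr p) ?N"
    by (rule has_bochner_integral_circle_translate[where h = "\<lambda>t. norm (f t) powr p",
          OF per has_bochner_integral_integrable[OF int]])
  have both: "has_bochner_integral circle_measure
      (\<lambda>t. 2 powr p * (norm (f (t - s)) powr p + norm (f t) powr p)) (2 powr p * (?N + ?N))"
    by (intro has_bochner_integral_mult_right has_bochner_integral_add shift
        has_bochner_integral_integrable int)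
  have "(\<integral>\<^sup>+t. ennreal (norm (f (t - s) - f t) powr p) \<partial>circle_measure)
    \<le> (\<integral>\<^sup>+t. ennreal (2 powr p * (norm (f (t - s)) powr p + norm (f t) powr p)) \<partial>circle_measure)"
    using p by (intro nn_integral_mono ennreal_leI norm_diff_powr_le) auto
  also have "\<dots> = ennreal (2 powr p * (?N + ?N))"
    using both unfolding has_bochner_integral_iff
    by (subst nn_integral_eq_integral) auto
  finally show ?thesis by (simp only: mult_2)
qed

text \<open>The pointwise form of the estimate. Finiteness of the right-hand side is assumed because the convolution integral at \<open>t\<close>
  may otherwise diverge; the factor \<open>1 / (2 * pi)\<close> of the convolution is at most \<open>1\<close> and is dropped.\<close>

lemma norm_conv_circle_minus_powr_le:
  fixes k f :: "real \<Rightarrow> complex"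
  assumes p: "1 \<le> p"
    and k: "\<And>x. k (x + 2 * pi) = k x" "integrable circle_measure k"
      "(LINT t|circle_measure. k t) = complex_of_real (2 * pi)"
    and f: "\<And>x. f (x + 2 * pi) = f x" "f \<in> borel_measurable lebesgue"
    and C: "(LINT t|circle_measure. norm (k t)) \<le> C"
    and fin: "(\<integral>\<^sup>+s. ennreal (norm (k s)) * ennreal (norm (f (t - s) - f t) powr p) \<partial>circle_measure) < \<infinity>"
  shows "ennreal (norm (conv_circle k f t - f t) powr p) \<le> ennreal (C powr (p - 1)) *
    (\<integral>\<^sup>+s. ennreal (norm (k s)) * ennreal (norm (f (t - s) - f t) powr p) \<partial>circle_measure)"
proof -
  define u where "u s = norm (k s)" for s
  define y where "y s = norm (f (t - s) - f t)" for s
  have kM[measurable]: "k \<in> borel_measurable circle_measure" using k by auto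
  have fM[measurable]: "(\<lambda>s. f (t - s)) \<in> borel_measurable circle_measure"
    using borel_measurable_reflect[OF f(2)] by (rule measurable_restrict_space1)
  have u: "integrable circle_measure u" "\<And>s. 0 \<le> u s"
    using k(2) by (auto simp: u_def[abs_def])
  \<comment> \<open>The mass of \<open>\<bar>k\<bar>\<close> is at least \<open>2\<pi>\<close>, hence positive.\<close>
  have u_pos: "0 < (LINT s|circle_measure. u s)"
  proof -
    have "2 * pi = norm (LINT t|circle_measure. k t)" using k(3) by simp
    also have "\<dots> \<le> (LINT s|circle_measure. u s)" unfolding u_def by (rule integral_norm_bound)
    finally show ?thesis using pi_gt_zero by linarith
  qed
  have y: "y \<in> borel_measurable circle_measure" "\<And>s. 0 \<le> y s"
    unfolding y_def by measurable
  have fin': "(\<integral>\<^sup>+s. ennreal (norm (k s)) * ennreal (norm (f (t - s) - f t) powr p) \<partial>circle_measure)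
      = (\<integral>\<^sup>+s. ennreal (u s * y s powr p) \<partial>circle_measure)"
    by (simp add: u_def y_def ennreal_mult)
  have uy: "integrable circle_measure (\<lambda>s. u s * y s powr p)"
    using fin u y unfolding fin' by (intro integrableI_nonneg) auto
  have uy1: "integrable circle_measure (\<lambda>s. u s * y s)"
    by (rule integral_weighted_power_mean(1)[OF p u u_pos y uy])
  have I: "integrable circle_measure (\<lambda>s. k s * (f (t - s) - f t))"
    using uy1 by (rule Bochner_Integration.integrable_bound) (auto simp: u_def y_def norm_mult)
  have "norm (conv_circle k f t - f t) = 1 / (2 * pi) * norm (LINT s|circle_measure. k s * (f (t - s) - f t))"
    unfolding conv_circle_minus[of k f, OF k(1) f(1) k(2,3) I] by (simp add: norm_mult norm_divide)
  also have "\<dots> \<le> 1 * norm (LINT s|circle_measure. k s * (f (t - s) - f t))"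
    using pi_gt3 by (intro mult_right_mono) auto
  also have "\<dots> \<le> (LINT s|circle_measure. u s * y s)"
    using integral_norm_bound[of circle_measure "\<lambda>s. k s * (f (t - s) - f t)"]
    by (simp add: u_def y_def norm_mult)
  finally have "norm (conv_circle k f t - f t) powr p \<le> (LINT s|circle_measure. u s * y s) powr p"
    using p by (intro powr_mono2) auto
  also have "\<dots> \<le> (LINT s|circle_measure. u s) powr (p - 1) * (LINT s|circle_measure. u s * y s powr p)"
    by (rule integral_weighted_power_mean(2)[OF p u u_pos y uy])
  also have "\<dots> \<le> C powr (p - 1) * (LINT s|circle_measure. u s * y s powr p)"
    using p u u_pos C by (intro mult_right_mono powr_mono2) (auto simp: u_def)
  finally have "ennreal (norm (conv_circle k f t - f t) powr p)
      \<le> ennreal (C powr (p - 1) * (LINT s|circle_measure. u s * y s powr p))"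
    by (rule ennreal_leI)
  also have "\<dots> = ennreal (C powr (p - 1)) * (\<integral>\<^sup>+s. ennreal (u s * y s powr p) \<partial>circle_measure)"
    using uy u by (subst nn_integral_eq_integral) (auto simp: ennreal_mult)
  finally show ?thesis unfolding fin' .
qed

text \<open>Integrating the pointwise estimate over \<open>t\<close> and interchanging the integrals leaves the \<open>L\<^sup>p\<close> modulus of continuity of \<open>f\<close>
  against the weight \<open>\<bar>k\<bar>\<close>. The modulus is bounded, so the double integral is finite and the pointwise estimate is available for almost every \<open>t\<close>.\<close>

lemma conv_circle_minus_Lp_le:
  fixes k f :: "real \<Rightarrow> complex"
  assumes p: "1 \<le> p"
    and k: "\<And>x. k (x + 2 * pi) = k x" "k \<in> borel_measurable lebesgue" "integrable circle_measure k"
      "(LINT t|circle_measure. k t) = complex_of_real (2 * pi)"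
    and C: "(LINT t|circle_measure. norm (k t)) \<le> C"
    and f: "f \<in> Lp_circle p"
  shows "(\<integral>\<^sup>+t. ennreal (norm (conv_circle k f t - f t) powr p) \<partial>circle_measure)
    \<le> ennreal (C powr (p - 1)) * (\<integral>\<^sup>+s. ennreal (norm (k s)) *
        (\<integral>\<^sup>+t. ennreal (norm (f (t - s) - f t) powr p) \<partial>circle_measure) \<partial>circle_measure)"
proof -
  have f': "\<And>x. f (x + 2 * pi) = f x" "f \<in> borel_measurable lebesgue"
    using f by (auto simp: Lp_circle_iff)
  define F where "F t s = ennreal (norm (k s)) * ennreal (norm (f (t - s) - f t) powr p)" for t s
  define \<omega> where "\<omega> s = (\<integral>\<^sup>+t. ennreal (norm (f (t - s) - f t) powr p) \<partial>circle_measure)" for s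
  define B where "B = 2 powr p * (2 * (LINT t|circle_measure. norm (f t) powr p))"
  have kM[measurable]: "k \<in> borel_measurable circle_measure" using k by auto
  have fM[measurable]: "f \<in> borel_measurable circle_measure" "(\<lambda>t. f (t - s)) \<in> borel_measurable circle_measure" for s
    using f' borel_measurable_translate[OF f'(2)] by (auto intro: measurable_restrict_space1)
  have inner: "(\<integral>\<^sup>+t. F t s \<partial>circle_measure) = ennreal (norm (k s)) * \<omega> s" for s
    unfolding F_def \<omega>_def by (rule nn_integral_cmult) measurable
  have swap: "(\<integral>\<^sup>+t. (\<integral>\<^sup>+s. F t s \<partial>circle_measure) \<partial>circle_measure)
      = (\<integral>\<^sup>+s. ennreal (norm (k s)) * \<omega> s \<partial>circle_measure)"
    unfolding inner[symmetric] unfolding F_def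
    by (rule tonelli_convolution_difference(1)[OF k(2) f'(2)])
  have "(\<integral>\<^sup>+s. ennreal (norm (k s)) * \<omega> s \<partial>circle_measure)
      \<le> (\<integral>\<^sup>+s. ennreal (norm (k s)) * ennreal B \<partial>circle_measure)"
    using translation_difference_Lp_bounded[OF p f] unfolding \<omega>_def B_def
    by (intro nn_integral_mono mult_left_mono) auto
  also have "\<dots> = (\<integral>\<^sup>+s. ennreal (norm (k s)) \<partial>circle_measure) * ennreal B"
    by (rule nn_integral_multc) measurable
  also have "\<dots> < \<infinity>"
    using k(3) by (auto simp: integrable_iff_bounded ennreal_mult_less_top)
  finally have swap_fin: "(\<integral>\<^sup>+t. (\<integral>\<^sup>+s. F t s \<partial>circle_measure) \<partial>circle_measure) < \<infinity>"
    unfolding swap .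
  obtain D where D[measurable]: "D \<in> borel_measurable circle_measure"
    and FD: "AE t in circle_measure. (\<integral>\<^sup>+s. F t s \<partial>circle_measure) = D t"
    using tonelli_convolution_difference(2)[OF k(2) f'(2), of p] unfolding F_def by blast
  have D_int: "(\<integral>\<^sup>+t. (\<integral>\<^sup>+s. F t s \<partial>circle_measure) \<partial>circle_measure) = (\<integral>\<^sup>+t. D t \<partial>circle_measure)"
    by (rule nn_integral_cong_AE[OF FD])
  have fin: "AE t in circle_measure. D t \<noteq> \<infinity>"
    using swap_fin unfolding D_int by (intro nn_integral_PInf_AE) auto
  have "(\<integral>\<^sup>+t. ennreal (norm (conv_circle k f t - f t) powr p) \<partial>circle_measure)
    \<le> (\<integral>\<^sup>+t. ennreal (C powr (p - 1)) * D t \<partial>circle_measure)"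
  proof (rule nn_integral_mono_AE)
    show "AE t in circle_measure. ennreal (norm (conv_circle k f t - f t) powr p) \<le> ennreal (C powr (p - 1)) * D t"
      using fin FD
    proof eventually_elim
      case (elim t)
      then have "(\<integral>\<^sup>+s. F t s \<partial>circle_measure) < \<infinity>" by (simp add: less_top)
      from norm_conv_circle_minus_powr_le[of p k f C t, OF p k(1,3,4) f' C this[unfolded F_def]]
      show ?case unfolding elim(2)[symmetric] F_def .
    qed
  qed
  also have "\<dots> = ennreal (C powr (p - 1)) * (\<integral>\<^sup>+t. D t \<partial>circle_measure)"
    by (rule nn_integral_cmult) measurable
  finally show ?thesis unfolding D_int[symmetric] swap \<omega>_def .
qed

section \<open>Continuous periodic functions\<close>

text \<open>On an interval that contains one period with a margin of \<open>1\<close> at both ends this is uniform continuity on a compact set; periodicity brings every \<open>t\<close> into that period.\<close>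

lemma uniformly_continuous_periodic:
  fixes f :: "real \<Rightarrow> complex"
  assumes per: "\<And>x. f (x + 2 * pi) = f x" and cont: "continuous_on UNIV f" and e: "0 < e"
  shows "\<exists>d>0. \<forall>t s. \<bar>s\<bar> \<le> d \<longrightarrow> norm (f (t - s) - f t) \<le> e"
proof -
  have "uniformly_continuous_on {-1..2 * pi + 1} f"
    using cont by (intro compact_uniformly_continuous) (auto intro: continuous_on_subset)
  then obtain d where d: "d > 0" and
    uc: "\<And>x y. x \<in> {-1..2 * pi + 1} \<Longrightarrow> y \<in> {-1..2 * pi + 1} \<Longrightarrow> dist x y < d \<Longrightarrow> dist (f x) (f y) < e"
    unfolding uniformly_continuous_on_def using e by metis
  show ?thesis
  proof (intro exI conjI allI impI)
    show "0 < min (d / 2) 1" using d by simp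
    fix t s :: real assume s: "\<bar>s\<bar> \<le> min (d / 2) 1"
    obtain r where r: "0 \<le> r" "r \<le> 2 * pi" and fr: "\<And>s. f (t - s) = f (r - s)"
      using periodic_reduce[of f t, OF per] by blast
    have "f (t - s) = f (r - s)" "f t = f r" using fr[of s] fr[of 0] by simp_all
    moreover have "dist (f (r - s)) (f r) < e"
      using r s d by (intro uc) (auto simp: dist_real_def)
    ultimately show "norm (f (t - s) - f t) \<le> e" by (simp add: dist_norm)
  qed
qed

lemma bounded_periodic:
  fixes f :: "real \<Rightarrow> complex"
  assumes per: "\<And>x. f (x + 2 * pi) = f x" and cont: "continuous_on UNIV f"
  obtains B where "0 \<le> B" "\<And>t. norm (f t) \<le> B"
proof -
  have "bounded (f ` {0..2 * pi})"
    using cont by (intro compact_imp_bounded compact_continuous_image) (auto intro: continuous_on_subset)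
  then obtain B where B: "\<And>t. t \<in> {0..2 * pi} \<Longrightarrow> norm (f t) \<le> B"
    unfolding bounded_iff by (metis imageI)
  have "norm (f t) \<le> B" for t
  proof -
    obtain r where "0 \<le> r" "r \<le> 2 * pi" "\<And>s. f (t - s) = f (r - s)"
      using periodic_reduce[of f t, OF per] by blast
    from B[of r] this(1,2) this(3)[of 0] show ?thesis by simp
  qed
  moreover from this[of 0] have "0 \<le> B" by (rule order_trans[OF norm_ge_zero])
  ultimately show thesis using that by blast
qed

text \<open>Dominated convergence: \<open>f\<close> is bounded, hence \<open>\<bar>k\<bar>\<close> times a constant dominates.\<close>

lemma conv_circle_continuous:
  fixes k f :: "real \<Rightarrow> complex"
  assumes k: "\<And>x. k (x + 2 * pi) = k x" "integrable circle_measure k"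
    and f: "f \<in> C_circle"
  shows "continuous_on UNIV (conv_circle k f)"
proof -
  have per: "\<And>x. f (x + 2 * pi) = f x" and cont: "continuous_on UNIV f"
    using f by (auto simp: C_circle_iff)
  obtain B where B: "0 \<le> B" "\<And>t. norm (f t) \<le> B"
    using bounded_periodic[of f, OF per cont] by blast
  have kM[measurable]: "k \<in> borel_measurable circle_measure" using k by auto
  have fM: "f \<in> borel_measurable lebesgue"
    using cont by (intro measurable_completion) (simp add: borel_measurable_continuous_onI)
  have [measurable]: "(\<lambda>s. f (t - s)) \<in> borel_measurable circle_measure" for t
    using borel_measurable_reflect[OF fM] by (rule measurable_restrict_space1)
  have "(\<lambda>i. conv_circle k f (x i)) \<longlonglongrightarrow> conv_circle k f t" if x: "x \<longlonglongrightarrow> t" for x t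
    unfolding conv_circle_eq[of k f, OF k(1) per]
  proof (intro tendsto_mult_left integral_dominated_convergence)
    show "integrable circle_measure (\<lambda>s. B * norm (k s))" using k by auto
    show "AE s in circle_measure. norm (k s * f (x i - s)) \<le> B * norm (k s)" for i
      unfolding norm_mult
      by (rule AE_I2, subst mult.commute, rule mult_right_mono[OF B(2) norm_ge_zero])
    show "AE s in circle_measure. (\<lambda>i. k s * f (x i - s)) \<longlonglongrightarrow> k s * f (t - s)"
    proof (intro AE_I2 tendsto_mult_left)
      show "(\<lambda>i. f (x i - s)) \<longlonglongrightarrow> f (t - s)" for s
        by (rule continuous_on_tendsto_compose[OF cont]) (auto intro!: tendsto_intros x)
    qed
  qed measurable
  then show ?thesis
    by (auto simp: continuous_on_eq_continuous_at continuous_at_sequentially comp_def)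
qed

section \<open>Convergence of the convolutions\<close>

text \<open>The weight is \<open>\<omega>\<close>, the \<open>p\<close>-th power of the \<open>L\<^sup>p\<close> modulus of continuity of \<open>f\<close>. Membership of the convolutions in \<open>L\<^sup>p\<close> is read off from the same
  estimate, since it bounds their difference from \<open>f\<close>.\<close>

lemma converges_in_Lp_conv_circle:
  assumes k: "summability_kernel k" and p: "1 \<le> p" and f: "f \<in> Lp_circle p"
  shows "converges_in_Lp p (\<lambda>n. conv_circle (k n) f) f"
proof -
  have f': "\<And>x. f (x + 2 * pi) = f x" "f \<in> borel_measurable lebesgue"
    "integrable circle_measure (\<lambda>t. norm (f t) powr p)"
    using f by (auto simp: Lp_circle_iff)
  obtain C where C: "1 \<le> C" "\<And>n. (LINT t|circle_measure. norm (k n t)) \<le> C"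
    using summability_kernel_L1_bounded[OF k] by blast
  define \<omega> where "\<omega> s = (\<integral>\<^sup>+t. ennreal (norm (f (t - s) - f t) powr p) \<partial>circle_measure)" for s
  define B where "B = 2 powr p * (2 * (LINT t|circle_measure. norm (f t) powr p))"
  have B: "0 \<le> B" unfolding B_def by auto
  have \<omega>_le: "\<omega> s \<le> ennreal B" for s
    using translation_difference_Lp_bounded[OF p f] unfolding \<omega>_def B_def .
  define X where "X n = (\<integral>\<^sup>+t. ennreal (norm (conv_circle (k n) f t - f t) powr p) \<partial>circle_measure)" for n
  have X_le: "X n \<le> ennreal (C powr (p - 1)) * (\<integral>\<^sup>+s. ennreal (norm (k n s)) * \<omega> s \<partial>circle_measure)" for n
    unfolding X_def \<omega>_def
    by (rule conv_circle_minus_Lp_le[OF p summability_kernelD[OF k] C(2) f])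
  have convM: "conv_circle (k n) f \<in> borel_measurable lebesgue" for n
    using conv_circle_measurable[OF summability_kernelD(2)[OF k] f'(2)] by (intro measurable_completion) simp
  have [measurable]: "conv_circle (k n) f \<in> borel_measurable circle_measure" "f \<in> borel_measurable circle_measure" for n
    using convM f' by (auto intro: measurable_restrict_space1)
  have X_fin: "X n < \<infinity>" for n
  proof -
    have "(\<integral>\<^sup>+s. ennreal (norm (k n s)) * \<omega> s \<partial>circle_measure)
      \<le> (\<integral>\<^sup>+s. ennreal (norm (k n s)) * ennreal B \<partial>circle_measure)"
      using \<omega>_le by (intro nn_integral_mono mult_left_mono) auto
    also have "\<dots> = (\<integral>\<^sup>+s. ennreal (norm (k n s)) \<partial>circle_measure) * ennreal B"
      using summability_kernelD(3)[OF k, of n] by (intro nn_integral_multc) auto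
    also have "\<dots> < \<infinity>"
      using summability_kernelD(3)[OF k, of n] by (auto simp: integrable_iff_bounded ennreal_mult_less_top)
    finally show ?thesis using X_le[of n] by (auto intro: le_less_trans simp: ennreal_mult_less_top)
  qed
  have diff_int: "integrable circle_measure (\<lambda>t. norm (conv_circle (k n) f t - f t) powr p)" for n
    using X_fin[of n] unfolding X_def by (intro integrableI_nonneg) auto
  have X_eq: "(LINT t|circle_measure. norm (conv_circle (k n) f t - f t) powr p) = enn2real (X n)" for n
    unfolding X_def by (rule integral_eq_nn_integral) auto
  have conv_Lp: "conv_circle (k n) f \<in> Lp_circle p" for n
    unfolding Lp_circle_iff
  proof (intro conjI allI convM conv_circle_periodic summability_kernelD(1)[OF k])
    have "integrable circle_measure (\<lambda>t. 2 powr p * (norm (conv_circle (k n) f t - f t) powr p + norm (f t) powr p))"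
      using diff_int f'(3) by auto
    then show "integrable circle_measure (\<lambda>t. norm (conv_circle (k n) f t) powr p)"
      by (rule Bochner_Integration.integrable_bound)
         (use p norm_add_powr_le[of p "conv_circle (k n) f t - f t" "f t" for t n] in auto)
  qed
  have X_lim: "(\<lambda>n. enn2real (X n)) \<longlonglongrightarrow> 0"
  proof (rule tendstoI)
    fix e :: real assume e: "0 < e"
    define e' where "e' = e / (2 * C powr (p - 1))"
    have e': "0 < e'" using e C(1) by (simp add: e'_def)
    have "\<forall>\<^sub>F n in sequentially. \<forall>w\<in>{\<omega>}. (\<integral>\<^sup>+s. ennreal (norm (k n s)) * w s \<partial>circle_measure) \<le> ennreal e'"
    proof (rule summability_kernel_uniform_decay[OF k _ _ B e'])
      show "\<exists>d>0. \<forall>w\<in>{\<omega>}. \<forall>s. \<bar>s\<bar> \<le> d \<longrightarrow> w s \<le> ennreal \<epsilon>" if "0 < \<epsilon>" for \<epsilon> :: real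
        using translation_continuous_in_Lp[of p f \<epsilon>, OF p f' that] by (simp add: \<omega>_def)
    qed (use \<omega>_le in auto)
    then show "\<forall>\<^sub>F n in sequentially. dist (enn2real (X n)) 0 < e"
    proof eventually_elim
      case (elim n)
      have "X n \<le> ennreal (C powr (p - 1)) * ennreal e'"
        using elim by (intro order_trans[OF X_le] mult_left_mono) auto
      also have "\<dots> = ennreal (e / 2)"
        using C(1) e by (simp add: e'_def flip: ennreal_mult)
      finally have "enn2real (X n) \<le> e / 2" using e by (intro enn2real_leI) auto
      then show ?case using e by simp
    qed
  qed
  have norm_eq: "Lp_norm_circle p (\<lambda>t. conv_circle (k n) f t - f t) = (1 / (2 * pi) * enn2real (X n)) powr (1 / p)" for n
    unfolding Lp_norm_circle_def X_eq[symmetric]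
    by (simp add: integral_restrict_space set_lebesgue_integral_def)
  have "(\<lambda>n. (1 / (2 * pi) * enn2real (X n)) powr (1 / p)) \<longlonglongrightarrow> (1 / (2 * pi) * 0) powr (1 / p)"
    using p by (intro tendsto_powr' tendsto_mult_left X_lim tendsto_const) auto
  then have "(\<lambda>n. Lp_norm_circle p (\<lambda>t. conv_circle (k n) f t - f t)) \<longlonglongrightarrow> 0"
    unfolding norm_eq by simp
  with conv_Lp f show ?thesis by (simp add: converges_in_Lp_def)
qed

text \<open>The weights are the functions \<open>s \<mapsto> \<bar>f (t - s) - f t\<bar>\<close>, one for each \<open>t\<close>; uniform continuity makes them small near \<open>0\<close> simultaneously, and
  the pointwise estimate with \<open>p = 1\<close> then bounds the error at every \<open>t\<close>.\<close>

lemma converges_in_C_conv_circle: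
  assumes k: "summability_kernel k" and f: "f \<in> C_circle"
  shows "converges_in_C (\<lambda>n. conv_circle (k n) f) f"
proof -
  have per: "\<And>x. f (x + 2 * pi) = f x" and cont: "continuous_on UNIV f"
    using f by (auto simp: C_circle_iff)
  have fM: "f \<in> borel_measurable lebesgue"
    using cont by (intro measurable_completion) (simp add: borel_measurable_continuous_onI)
  obtain B where B: "0 \<le> B" "\<And>t. norm (f t) \<le> B"
    using bounded_periodic[of f, OF per cont] by blast
  obtain C where C: "1 \<le> C" "\<And>n. (LINT t|circle_measure. norm (k n t)) \<le> C"
    using summability_kernel_L1_bounded[OF k] by blast
  \<comment> \<open>The trivial power keeps the weights in the form of the pointwise bound at exponent \<open>1\<close>.\<close>
  define w where "w t s = ennreal (norm (f (t - s) - f t) powr 1)" for t s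
  have w_le: "w t s \<le> ennreal (2 * B)" for t s
    using norm_triangle_ineq4[of "f (t - s)" "f t"] B(2)[of t] B(2)[of "t - s"]
    by (simp add: w_def ennreal_leI)
  have conv_C: "conv_circle (k n) f \<in> C_circle" for n
    unfolding C_circle_iff
    using conv_circle_periodic[of "k n"] conv_circle_continuous[of "k n", OF _ _ f] summability_kernelD[OF k, of n]
    by auto
  have "(\<lambda>n. sup_norm_circle (\<lambda>t. conv_circle (k n) f t - f t)) \<longlonglongrightarrow> 0"
  proof (rule tendstoI)
    fix e :: real assume e: "0 < e"
    have "\<forall>\<^sub>F n in sequentially. \<forall>v\<in>range w. (\<integral>\<^sup>+s. ennreal (norm (k n s)) * v s \<partial>circle_measure) \<le> ennreal (e / 2)"
    proof (rule summability_kernel_uniform_decay[OF k])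
      show "\<exists>d>0. \<forall>v\<in>range w. \<forall>s. \<bar>s\<bar> \<le> d \<longrightarrow> v s \<le> ennreal \<epsilon>" if "0 < \<epsilon>" for \<epsilon> :: real
        using uniformly_continuous_periodic[of f, OF per cont that] by (auto simp: w_def intro: ennreal_leI)
      show "v s \<le> ennreal (2 * B)" if "v \<in> range w" for v s using that w_le by auto
    qed (use B e in auto)
    then show "\<forall>\<^sub>F n in sequentially. dist (sup_norm_circle (\<lambda>t. conv_circle (k n) f t - f t)) 0 < e"
    proof eventually_elim
      case (elim n)
      have le: "norm (conv_circle (k n) f t - f t) \<le> e / 2" for t
      proof -
        have int_le: "(\<integral>\<^sup>+s. ennreal (norm (k n s)) * w t s \<partial>circle_measure) \<le> ennreal (e / 2)"
          using elim by auto
        then have "(\<integral>\<^sup>+s. ennreal (norm (k n s)) * w t s \<partial>circle_measure) < \<infinity>"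
          by (rule le_less_trans) simp
        from norm_conv_circle_minus_powr_le[of 1 "k n" f, OF order_refl summability_kernelD(1,3,4)[OF k]
            per fM C(2) this[unfolded w_def]]
        have "ennreal (norm (conv_circle (k n) f t - f t))
            \<le> (\<integral>\<^sup>+s. ennreal (norm (k n s)) * w t s \<partial>circle_measure)"
          using C(1) by (simp add: w_def)
        also note int_le
        finally have "ennreal (norm (conv_circle (k n) f t - f t)) \<le> ennreal (e / 2)" .
        then show ?thesis using e by (simp add: ennreal_le_iff)
      qed
      have "sup_norm_circle (\<lambda>t. conv_circle (k n) f t - f t) \<le> e / 2"
        unfolding sup_norm_circle_def by (rule cSUP_least) (use le in auto)
      moreover have "0 \<le> sup_norm_circle (\<lambda>t. conv_circle (k n) f t - f t)"
        unfolding sup_norm_circle_def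
        by (rule cSUP_upper2[of _ _ 0]) (use le in \<open>auto intro!: bdd_aboveI2[where M = "e / 2"]\<close>)
      ultimately show ?case using e by simp
    qed
  qed
  with conv_C f show ?thesis by (simp add: converges_in_C_def)
qed

theorem theorem2p6:
  fixes k :: "nat \<Rightarrow> real \<Rightarrow> complex"
  assumes "summability_kernel k"
  shows "(\<forall>p f. 1 \<le> p \<longrightarrow> f \<in> Lp_circle p \<longrightarrow> converges_in_Lp p (\<lambda>n. conv_circle (k n) f) f) \<and>
         (\<forall>f. f \<in> C_circle \<longrightarrow> converges_in_C (\<lambda>n. conv_circle (k n) f) f)"
  using converges_in_Lp_conv_circle[OF assms] converges_in_C_conv_circle[OF assms] by blast

end
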